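(* Let $s\geq 1$, $k\geq 1$ be integers with $k-s+1\geq 0$, and let $n\geq 2k+1$. Let $G$ be a connected simple graph of order $n$ with minimum degree $\delta(G)\geq k$. If $$\mu(\overline{G})\leq \sqrt{(k-s+2)(n-k-1)},$$ then $G$ is $s$-connected unless $G\in EP_n$ or $G\in EC_n$.
   Context: For a simple graph $H$, $\overline{H}$ denotes its complement and $\mu(H)$ denotes the spectral radius (largest eigenvalue) of the adjacency matrix of $H$. For disjoint graphs $G_1,G_2$, the join $G_1\vee G_2$ is the graph on $V(G_1)\cup V(G_2)$ whose edges are those of $G_1$, those of $G_2$, and all edges $xy$ with $x\in V(G_1)$, $y\in V(G_2)$. $K_m$ is the complete graph on $m$ vertices. A graph is semi-regular bipartite if it is bipartite and vertices in the same part have the same degree. A graph $G$ is $s$-connected if it has more than $s$ vertices and remains connected whenever fewer than $s$ vertices are deleted. $EP_n$ (depending on $n$ and $k$) is the set of graphs of order $n$ of the form $G_1\vee G_2$, where, for some integer $r$ with $0\le r\le k$, $G_1$ is an $r$-regular graph of order $n-k+r$ and $G_2$ is a spanning subgraph of $K_{k-r}$. $EC_n$ (depending on $n,k,s$) is the set of graphs of order $n$ of the form $\overline{G_1}\vee G_2$, where, for some integer $r$ with $s-1-r\geq 0$, $G_1$ is a semi-regular bipartite graph of order $n-s+1+r$ with parts $X,Y$ such that every $u\in X$ has $d_{G_1}(u)=k-s+2$ and every $v\in Y$ has $d_{G_1}(v)=n-k-1$, and $G_2$ is a graph with $|V(G_2)|=s-1-r$. *)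

theory Defs
  imports
    "Graph_Theory.Graph_Theory"
    "Jordan_Normal_Form.Spectral_Radius"
begin

text \<open>
  Finite simple graphs are symmetric, loop-free pair digraphs (locale \<^locale>\<open>pair_graph\<close>): an edge
  \<open>{u, v}\<close> is the pair of arcs \<open>(u, v)\<close>, \<open>(v, u)\<close>, so the degree of a vertex is its
  \<^const>\<open>out_degree\<close>. The null graph is a \<^locale>\<open>pair_graph\<close>.
\<close>

definition complement_graph :: "'a pair_pre_digraph \<Rightarrow> 'a pair_pre_digraph" where
  "complement_graph G =
     \<lparr> pverts = pverts G,
       parcs = {(u, v). u \<in> pverts G \<and> v \<in> pverts G \<and> u \<noteq> v \<and> (u, v) \<notin> parcs G} \<rparr>"

text \<open>Only meaningful for graphs with disjoint vertex sets.\<close>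

definition join_graph :: "'a pair_pre_digraph \<Rightarrow> 'a pair_pre_digraph \<Rightarrow> 'a pair_pre_digraph" where
  "join_graph G\<^sub>1 G\<^sub>2 =
     \<lparr> pverts = pverts G\<^sub>1 \<union> pverts G\<^sub>2,
       parcs = parcs G\<^sub>1 \<union> parcs G\<^sub>2 \<union> pverts G\<^sub>1 \<times> pverts G\<^sub>2 \<union> pverts G\<^sub>2 \<times> pverts G\<^sub>1 \<rparr>"

text \<open>
  The adjacency matrix depends on an enumeration of the vertices, fixed here by choice; another
  enumeration conjugates the matrix by a permutation matrix and leaves the spectrum unchanged.
\<close>

definition vertex_list :: "'a pair_pre_digraph \<Rightarrow> 'a list" where
  "vertex_list G = (SOME vs. distinct vs \<and> set vs = pverts G)"

definition adjacency_matrix :: "'a pair_pre_digraph \<Rightarrow> complex mat" where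
  "adjacency_matrix G =
     mat (card (pverts G)) (card (pverts G))
       (\<lambda>(i, j). if (vertex_list G ! i, vertex_list G ! j) \<in> parcs G then 1 else 0)"

definition graph_spectral_radius :: "'a pair_pre_digraph \<Rightarrow> real" where
  "graph_spectral_radius G = spectral_radius (adjacency_matrix G)"

definition min_degree :: "'a pair_pre_digraph \<Rightarrow> nat" where
  "min_degree G = Min (out_degree G ` pverts G)"

definition regular_graph :: "nat \<Rightarrow> 'a pair_pre_digraph \<Rightarrow> bool" where
  "regular_graph r G \<longleftrightarrow> pair_graph G \<and> (\<forall>v \<in> pverts G. out_degree G v = r)"

definition bipartite_with_parts :: "'a pair_pre_digraph \<Rightarrow> 'a set \<Rightarrow> 'a set \<Rightarrow> bool" where
  "bipartite_with_parts G X Y \<longleftrightarrow>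
     pair_graph G \<and> X \<union> Y = pverts G \<and> X \<inter> Y = {} \<and> parcs G \<subseteq> X \<times> Y \<union> Y \<times> X"

definition semiregular_bipartite_with_parts ::
    "'a pair_pre_digraph \<Rightarrow> 'a set \<Rightarrow> 'a set \<Rightarrow> bool" where
  "semiregular_bipartite_with_parts G X Y \<longleftrightarrow>
     bipartite_with_parts G X Y \<and>
     (\<forall>u \<in> X. \<forall>u' \<in> X. out_degree G u = out_degree G u') \<and>
     (\<forall>v \<in> Y. \<forall>v' \<in> Y. out_degree G v = out_degree G v')"

definition s_connected :: "nat \<Rightarrow> 'a pair_pre_digraph \<Rightarrow> bool" where
  "s_connected s G \<longleftrightarrow>
     s < card (pverts G) \<and>
     (\<forall>S \<subseteq> pverts G. card S < s \<longrightarrow>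
        Digraph_Component.connected (induce_subgraph G (pverts G - S)))"

text \<open>
  ``Of the form \<open>G\<^sub>1 \<or> G\<^sub>2\<close>'' can be read as an equality rather than an isomorphism, since \<open>G\<^sub>1\<close>
  and \<open>G\<^sub>2\<close> range over all graphs on the same vertex type.
\<close>

definition EP :: "nat \<Rightarrow> nat \<Rightarrow> 'a pair_pre_digraph set" where
  "EP n k = {G. card (pverts G) = n \<and>
     (\<exists>(r::nat) G\<^sub>1 G\<^sub>2. r \<le> k \<and>
        regular_graph r G\<^sub>1 \<and> int (card (pverts G\<^sub>1)) = int n - int k + int r \<and>
        pair_graph G\<^sub>2 \<and>
        (\<exists>K :: 'a pair_pre_digraph. complete_digraph (k - r) K \<and> spanning G\<^sub>2 K) \<and>
        pverts G\<^sub>1 \<inter> pverts G\<^sub>2 = {} \<and>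
        G = join_graph G\<^sub>1 G\<^sub>2)}"

text \<open>
  The integer \<open>r\<close> is not assumed nonnegative. As \<open>G\<^sub>1\<close> is not the null graph, the degree conditions
  force \<open>r \<ge> 0\<close> (for \<open>s \<le> k + 1\<close> and \<open>k + 1 < n\<close>); with the null graph admitted for \<open>G\<^sub>1\<close>, taking
  \<open>r = s - 1 - n\<close> would make every graph of order \<open>n\<close> a member.
\<close>

definition EC :: "nat \<Rightarrow> nat \<Rightarrow> nat \<Rightarrow> 'a pair_pre_digraph set" where
  "EC n k s = {G. card (pverts G) = n \<and>
     (\<exists>(r::int) G\<^sub>1 G\<^sub>2 X Y. int s - 1 - r \<ge> 0 \<and>
        semiregular_bipartite_with_parts G\<^sub>1 X Y \<and> pverts G\<^sub>1 \<noteq> {} \<and>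
        int (card (pverts G\<^sub>1)) = int n - int s + 1 + r \<and>
        (\<forall>u \<in> X. int (out_degree G\<^sub>1 u) = int k - int s + 2) \<and>
        (\<forall>v \<in> Y. int (out_degree G\<^sub>1 v) = int n - int k - 1) \<and>
        pair_graph G\<^sub>2 \<and> int (card (pverts G\<^sub>2)) = int s - 1 - r \<and>
        pverts G\<^sub>1 \<inter> pverts G\<^sub>2 = {} \<and>
        G = join_graph (complement_graph G\<^sub>1) G\<^sub>2)}"

end

theory Submission
  imports Defs "HOL-Analysis.Convex"
begin

text \<open>
  If \<open>S\<close> with \<open>card S = t < s\<close> separates \<open>G\<close> into \<open>A\<close> and \<open>B\<close>, the complement of \<open>G\<close> contains the
  complete bipartite graph on \<open>A\<close>, \<open>B\<close>, so its spectral radius is at least \<open>sqrt (card A * card B)\<close>.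
  The minimum degree forces \<open>card A, card B \<ge> k + 1 - t\<close>, hence
  \<open>card A * card B \<ge> (k + 1 - t) * (n - k - 1)\<close>. The spectral bound therefore gives \<open>t = s - 1\<close> and
  equality throughout, and in the equality case the complement has no further edge at \<open>A \<union> B\<close>:
  \<open>G\<close> lies in \<open>EC\<close>, with \<open>r = 0\<close> and a complete bipartite \<open>G\<^sub>1\<close>.
\<close>

section \<open>Rayleigh quotients and the spectral radius\<close>

lemma spectral_radius_nonneg:
  assumes "A \<in> carrier_mat n n" and "n > 0"
  shows "spectral_radius A \<ge> 0"
  using spectral_radius_mem_max(1)[OF assms] by auto

text \<open>An eigenvalue \<open>l\<close> of the scaled matrix is \<open>c\<close> times the
  eigenvalue \<open>l / c\<close> of \<open>A\<close>. With \<open>c = 1 / r\<close> this brings a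
  matrix to spectral radius below 1.\<close>

lemma spectral_radius_smult_le:
  assumes A: "A \<in> carrier_mat n n" and "n > 0" and "c \<noteq> 0"
  shows "spectral_radius (c \<cdot>\<^sub>m A) \<le> norm c * spectral_radius A"
proof -
  have cA: "c \<cdot>\<^sub>m A \<in> carrier_mat n n"
    using A by simp
  obtain l where l: "eigenvalue (c \<cdot>\<^sub>m A) l" and eq: "spectral_radius (c \<cdot>\<^sub>m A) = norm l"
    using spectral_radius_mem_max(1)[OF cA \<open>n > 0\<close>] by (auto simp: spectrum_def)
  from l obtain v where v: "v \<in> carrier_vec n" "v \<noteq> 0\<^sub>v n" and ev: "(c \<cdot>\<^sub>m A) *\<^sub>v v = l \<cdot>\<^sub>v v"
    using A by (auto simp: eigenvalue_def eigenvector_def)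
  have "A *\<^sub>v v = (l / c) \<cdot>\<^sub>v v"
  proof (rule eq_vecI)
    fix i assume "i < dim_vec ((l / c) \<cdot>\<^sub>v v)"
    then have i: "i < n" using v by simp
    have "((c \<cdot>\<^sub>m A) *\<^sub>v v) $ i = c * (A *\<^sub>v v) $ i"
      using A v i by simp
    then show "(A *\<^sub>v v) $ i = ((l / c) \<cdot>\<^sub>v v) $ i"
      using ev v i \<open>c \<noteq> 0\<close> by (simp add: field_simps)
  qed (use A v in auto)
  then have "eigenvalue A (l / c)"
    using v A unfolding eigenvalue_def eigenvector_def by auto
  then have "norm (l / c) \<le> spectral_radius A"
    using spectral_radius_mem_max(2)[OF A \<open>n > 0\<close>] by (auto simp: spectrum_def)
  then show ?thesis
    using eq \<open>c \<noteq> 0\<close> by (simp add: norm_divide field_simps)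
qed

text \<open>Kept over the reals, where squared norms and Cauchy-Schwarz apply directly; the spectral
  radius, by contrast, belongs to a complex matrix.\<close>

definition mat_apply :: "nat \<Rightarrow> (nat \<Rightarrow> nat \<Rightarrow> real) \<Rightarrow> (nat \<Rightarrow> real) \<Rightarrow> nat \<Rightarrow> real" where
  "mat_apply n a x = (\<lambda>i. \<Sum>j<n. a i j * x j)"

text \<open>Carries bounds on the entries of complex matrix powers over to the real iterates. The
  induction keeps \<open>x\<close> arbitrary, since one factor \<open>A\<close> is absorbed into the
  vector before the other \<open>k\<close> act.\<close>

lemma pow_mat_mult_vec_of_real:
  fixes n :: nat and a :: "nat \<Rightarrow> nat \<Rightarrow> real"
  defines "A \<equiv> mat n n (\<lambda>(i, j). complex_of_real (a i j))"
  shows "A ^\<^sub>m k *\<^sub>v vec n (\<lambda>i. complex_of_real (x i))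
    = vec n (\<lambda>i. complex_of_real ((mat_apply n a ^^ k) x i))"
proof (induction k arbitrary: x)
  case 0
  then show ?case by (simp add: A_def)
next
  case (Suc k)
  have A: "A \<in> carrier_mat n n" by (simp add: A_def)
  have "A *\<^sub>v vec n (\<lambda>i. complex_of_real (x i)) = vec n (\<lambda>i. complex_of_real (mat_apply n a x i))"
    by (rule eq_vecI) (auto simp: A_def mat_apply_def scalar_prod_def lessThan_atLeast0)
  then have "A ^\<^sub>m Suc k *\<^sub>v vec n (\<lambda>i. complex_of_real (x i))
      = A ^\<^sub>m k *\<^sub>v vec n (\<lambda>i. complex_of_real (mat_apply n a x i))"
    using A by (simp add: assoc_mult_mat_vec[of _ n n _ n])
  then show ?case
    by (simp add: Suc.IH funpow_Suc_right del: funpow.simps)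
qed

lemma mat_apply_self_adjoint:
  assumes "\<And>i j. i < n \<Longrightarrow> j < n \<Longrightarrow> a i j = a j i"
  shows "(\<Sum>i<n. mat_apply n a x i * y i) = (\<Sum>i<n. x i * mat_apply n a y i)"
proof -
  have "(\<Sum>i<n. mat_apply n a x i * y i) = (\<Sum>i<n. \<Sum>j<n. a i j * x j * y i)"
    by (simp add: mat_apply_def sum_distrib_right)
  also have "\<dots> = (\<Sum>j<n. \<Sum>i<n. a i j * x j * y i)"
    by (rule sum.swap)
  also have "\<dots> = (\<Sum>j<n. x j * mat_apply n a y j)"
    using assms by (auto simp: mat_apply_def sum_distrib_left ac_simps intro!: sum.cong)
  finally show ?thesis .
qed

text \<open>
  For symmetric \<open>a\<close> the squared norms \<open>N k\<close> of the iterates satisfy \<open>(N (k + 1))\<^sup>2 \<le> N k * N (k + 2)\<close>,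
  so a Rayleigh quotient above 1 makes them grow geometrically, whereas a spectral radius below 1
  keeps the powers of the matrix bounded.
\<close>

lemma rayleigh_le_of_spectral_radius_less_1:
  fixes a :: "nat \<Rightarrow> nat \<Rightarrow> real" and x :: "nat \<Rightarrow> real"
  assumes sym: "\<And>i j. i < n \<Longrightarrow> j < n \<Longrightarrow> a i j = a j i"
    and sr: "spectral_radius (mat n n (\<lambda>(i, j). complex_of_real (a i j))) < 1"
  shows "(\<Sum>i<n. x i * mat_apply n a x i) \<le> (\<Sum>i<n. (x i)\<^sup>2)"
proof (rule ccontr)
  define A where "A = mat n n (\<lambda>(i, j). complex_of_real (a i j))"
  have A: "A \<in> carrier_mat n n" by (simp add: A_def)
  define f where "f k = (mat_apply n a ^^ k) x" for k
  define N where "N k = (\<Sum>i<n. (f k i)\<^sup>2)" for k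
  have f0: "f 0 = x" and fS: "f (Suc k) = mat_apply n a (f k)" for k
    by (simp_all add: f_def)
  have N_nonneg: "N k \<ge> 0" for k
    by (simp add: N_def sum_nonneg)
  assume "\<not> ?thesis"
  then have gt: "(\<Sum>i<n. f 0 i * f 1 i) > N 0"
    using fS[of 0] by (simp add: f0 N_def)
  have "N 0 \<noteq> 0"
  proof
    assume "N 0 = 0"
    then have "\<forall>i<n. f 0 i = 0"
      by (simp add: N_def sum_nonneg_eq_0_iff)
    then have "(\<Sum>i<n. f 0 i * f 1 i) = 0"
      by simp
    with gt \<open>N 0 = 0\<close> show False by simp
  qed
  then have N0: "N 0 > 0"
    using N_nonneg[of 0] by simp
  have "(N 0)\<^sup>2 < (\<Sum>i<n. f 0 i * f 1 i)\<^sup>2"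
    using gt N0 by (intro power_strict_mono) auto
  also have "\<dots> \<le> N 0 * N 1"
    unfolding N_def by (rule Cauchy_Schwarz_ineq_sum)
  finally have N01: "N 0 < N 1"
    using N0 by (simp add: power2_eq_square)
  have log_convex: "(N (Suc k))\<^sup>2 \<le> N k * N (Suc (Suc k))" for k
  proof -
    \<comment> \<open>Self-adjointness moves one application of the matrix to the other factor,
      which makes Cauchy-Schwarz compare three consecutive norms.\<close>
    have "N (Suc k) = (\<Sum>i<n. f k i * f (Suc (Suc k)) i)"
      using mat_apply_self_adjoint[OF sym, where x = "f k" and y = "f (Suc k)"]
      by (simp add: N_def fS power2_eq_square)
    then show ?thesis
      unfolding N_def using Cauchy_Schwarz_ineq_sum[of "f k" "f (Suc (Suc k))" "{..<n}"] by simp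
  qed
  \<comment> \<open>By log-convexity the ratios \<open>N (Suc k) / N k\<close> never decrease, so
    the first one, which exceeds 1, bounds them all from below.\<close>
  define t where "t = N 1 / N 0"
  have t: "t > 1"
    using N0 N01 by (simp add: t_def)
  have step: "N k > 0 \<and> N (Suc k) \<ge> t * N k" for k
  proof (induction k)
    case 0
    then show ?case using N0 by (simp add: t_def)
  next
    case (Suc k)
    have pos: "N (Suc k) > 0"
      using Suc t by (smt (verit) mult_pos_pos)
    have "(t * N k) * N (Suc k) \<le> N (Suc k) * N (Suc k)"
      using Suc pos by (intro mult_right_mono) auto
    also have "\<dots> \<le> N k * N (Suc (Suc k))"
      using log_convex[of k] by (simp add: power2_eq_square)
    finally have "N k * (t * N (Suc k)) \<le> N k * N (Suc (Suc k))"
      by (simp add: ac_simps)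
    then show ?case
      using pos Suc by simp
  qed
  have growth: "N k \<ge> t ^ k * N 0" for k
  proof (induction k)
    case (Suc k)
    have "t ^ Suc k * N 0 \<le> t * N k"
      using mult_left_mono[OF Suc, of t] t by (simp add: ac_simps)
    then show ?case using step[of k] by linarith
  qed simp
  \<comment> \<open>Spectral radius below 1 gives, via the Jordan normal form, a bound
    \<open>c\<close> on the entries that is uniform in the exponent.\<close>
  obtain c where c: "\<And>k. norm_bound (A ^\<^sub>m k) c"
    using spectral_radius_jnf_norm_bound_less_1_upper_triangular[OF A] sr unfolding A_def by blast
  define C where "C = (\<Sum>j<n. \<bar>c\<bar> * \<bar>x j\<bar>)"
  have bound: "\<bar>f k i\<bar> \<le> C" if i: "i < n" for k i
  proof -
    have dim: "A ^\<^sub>m k \<in> carrier_mat n n" using A by simp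
    have "complex_of_real (f k i) = (A ^\<^sub>m k *\<^sub>v vec n (\<lambda>i. complex_of_real (x i))) $ i"
      using i unfolding A_def by (subst pow_mat_mult_vec_of_real) (simp add: f_def)
    also have "\<dots> = (\<Sum>j<n. (A ^\<^sub>m k) $$ (i, j) * complex_of_real (x j))"
      using i dim A by (auto simp: scalar_prod_def lessThan_atLeast0 intro!: sum.cong)
    finally have "\<bar>f k i\<bar> = norm (\<Sum>j<n. (A ^\<^sub>m k) $$ (i, j) * complex_of_real (x j))"
      by (metis norm_of_real)
    also have "\<dots> \<le> (\<Sum>j<n. norm ((A ^\<^sub>m k) $$ (i, j)) * \<bar>x j\<bar>)"
      by (rule order_trans[OF norm_sum]) (simp add: norm_mult)
    also have "\<dots> \<le> C"
      unfolding C_def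
    proof (intro sum_mono mult_right_mono)
      fix j assume "j \<in> {..<n}"
      then have "norm ((A ^\<^sub>m k) $$ (i, j)) \<le> c"
        using c[of k] i A by (auto simp: norm_bound_def split: if_splits)
      then show "norm ((A ^\<^sub>m k) $$ (i, j)) \<le> \<bar>c\<bar>" by simp
    qed simp
    finally show ?thesis .
  qed
  have "N k \<le> (\<Sum>i<n. C\<^sup>2)" for k
    unfolding N_def
    by (intro sum_mono) (meson abs_ge_self abs_le_square_iff bound lessThan_iff order_trans)
  then have le: "t ^ k * N 0 \<le> real n * C\<^sup>2" for k
    using growth[of k] by (simp add: order_trans)
  obtain k where "real n * C\<^sup>2 / N 0 < t ^ k"
    using real_arch_pow[OF t] by blast
  then show False
    using le[of k] N0 by (simp add: field_simps)
qed

text \<open>Division by any \<open>r\<close> above the spectral radius reduces to spectral radius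
  below 1; then \<open>r\<close> descends to the spectral radius. Taking \<open>r\<close> strictly
  larger also keeps the division legitimate when the spectral radius is 0.\<close>

lemma rayleigh_le_spectral_radius:
  fixes a :: "nat \<Rightarrow> nat \<Rightarrow> real" and x :: "nat \<Rightarrow> real"
  assumes sym: "\<And>i j. i < n \<Longrightarrow> j < n \<Longrightarrow> a i j = a j i" and n: "n > 0"
  shows "(\<Sum>i<n. \<Sum>j<n. a i j * x i * x j)
    \<le> spectral_radius (mat n n (\<lambda>(i, j). complex_of_real (a i j))) * (\<Sum>i<n. (x i)\<^sup>2)"
proof -
  define A where "A = mat n n (\<lambda>(i, j). complex_of_real (a i j))"
  have A: "A \<in> carrier_mat n n" by (simp add: A_def)
  define q s where "q = (\<Sum>i<n. x i * mat_apply n a x i)" and "s = (\<Sum>i<n. (x i)\<^sup>2)"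
  have s: "s \<ge> 0" by (simp add: s_def sum_nonneg)
  have le: "q \<le> r * s" if r: "r > spectral_radius A" for r
  proof -
    have r0: "r > 0"
      using r spectral_radius_nonneg[OF A n] by linarith
    define b where "b i j = a i j / r" for i j
    have B: "mat n n (\<lambda>(i, j). complex_of_real (b i j)) = complex_of_real (1 / r) \<cdot>\<^sub>m A"
      by (rule eq_matI) (auto simp: A_def b_def)
    have "spectral_radius (mat n n (\<lambda>(i, j). complex_of_real (b i j)))
        \<le> norm (complex_of_real (1 / r)) * spectral_radius A"
      unfolding B using r0 by (intro spectral_radius_smult_le[OF A n]) auto
    also have "\<dots> < 1"
      using r r0 by (simp add: norm_divide)
    finally have "(\<Sum>i<n. x i * mat_apply n b x i) \<le> s"
      unfolding s_def using sym by (intro rayleigh_le_of_spectral_radius_less_1) (auto simp: b_def)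
    moreover have "(\<Sum>i<n. x i * mat_apply n b x i) = q / r"
      by (simp add: q_def mat_apply_def b_def sum_divide_distrib sum_distrib_left)
    ultimately show ?thesis
      using r0 by (simp add: field_simps)
  qed
  have "q \<le> spectral_radius A * s"
  proof (cases "s = 0")
    case True
    then show ?thesis using le[of "spectral_radius A + 1"] by simp
  next
    case False
    then have "s > 0" using s by simp
    then have "q / s \<le> r" if "r > spectral_radius A" for r
      using le[OF that] by (simp add: field_simps)
    then have "q / s \<le> spectral_radius A"
      by (rule dense_ge)
    then show ?thesis using \<open>s > 0\<close> by (simp add: field_simps)
  qed
  moreover have "q = (\<Sum>i<n. \<Sum>j<n. a i j * x i * x j)"
    by (simp add: q_def mat_apply_def sum_distrib_left ac_simps)
  ultimately show ?thesis
    by (simp add: A_def s_def)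
qed

section \<open>The Rayleigh bound for graphs\<close>

lemma vertex_list:
  assumes "finite (pverts G)"
  shows "distinct (vertex_list G)" and "set (vertex_list G) = pverts G"
proof -
  have "\<exists>vs. distinct vs \<and> set vs = pverts G"
    using finite_distinct_list[OF assms] by blast
  then have "distinct (vertex_list G) \<and> set (vertex_list G) = pverts G"
    unfolding vertex_list_def by (rule someI_ex)
  then show "distinct (vertex_list G)" and "set (vertex_list G) = pverts G" by auto
qed

text \<open>The arc sum is the quadratic form of the adjacency matrix, with each edge counted once
  per direction. Padded with zeros to all pairs of vertices, it can be reindexed along the
  enumeration \<open>w\<close>.\<close>

lemma graph_rayleigh_le:
  fixes H :: "'a pair_pre_digraph" and f :: "'a \<Rightarrow> real"
  assumes "pair_graph H" and ne: "pverts H \<noteq> {}"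
  shows "(\<Sum>(u, v)\<in>parcs H. f u * f v) \<le> graph_spectral_radius H * (\<Sum>v\<in>pverts H. (f v)\<^sup>2)"
proof -
  interpret pair_graph H by fact
  define n where "n = card (pverts H)"
  define w where "w i = vertex_list H ! i" for i
  note vl = vertex_list[OF pair_finite_verts]
  have len: "length (vertex_list H) = n"
    using distinct_card[OF vl(1)] vl(2) by (simp add: n_def)
  have bij: "bij_betw w {..<n} (pverts H)"
    using bij_betw_nth[OF vl(1)] len vl(2) by (simp add: w_def[abs_def] bij_betw_def inj_on_def)
  have n: "n > 0"
    using ne pair_finite_verts by (simp add: n_def card_gt_0_iff)
  define a where "a i j = (if (w i, w j) \<in> parcs H then 1 else 0 :: real)" for i j
  have adj: "adjacency_matrix H = mat n n (\<lambda>(i, j). complex_of_real (a i j))"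
    by (rule eq_matI) (auto simp: adjacency_matrix_def n_def a_def w_def)
  have "(\<Sum>(u, v)\<in>parcs H. f u * f v)
      = (\<Sum>(u, v)\<in>pverts H \<times> pverts H. if (u, v) \<in> parcs H then f u * f v else 0)"
    using in_arcsD1 in_arcsD2 pair_finite_verts
    by (intro sum.mono_neutral_cong_left) auto
  also have "\<dots> = (\<Sum>u\<in>pverts H. \<Sum>v\<in>pverts H. if (u, v) \<in> parcs H then f u * f v else 0)"
    by (rule sum.cartesian_product[symmetric])
  also have "\<dots> = (\<Sum>i<n. \<Sum>j<n. if (w i, w j) \<in> parcs H then f (w i) * f (w j) else 0)"
    by (simp add: sum.reindex_bij_betw[OF bij, symmetric])
  also have "\<dots> = (\<Sum>i<n. \<Sum>j<n. a i j * f (w i) * f (w j))"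
    by (intro sum.cong refl) (auto simp: a_def)
  also have "\<dots> \<le> spectral_radius (adjacency_matrix H) * (\<Sum>i<n. (f (w i))\<^sup>2)"
    unfolding adj using arcs_symmetric n
    by (intro rayleigh_le_spectral_radius) (auto simp: a_def)
  also have "(\<Sum>i<n. (f (w i))\<^sup>2) = (\<Sum>v\<in>pverts H. (f v)\<^sup>2)"
    by (rule sum.reindex_bij_betw[OF bij])
  finally show ?thesis
    by (simp add: graph_spectral_radius_def)
qed

section \<open>Graphs containing a complete bipartite graph\<close>

text \<open>For \<open>e = 0\<close> this is the Perron vector of the complete bipartite graph on
  \<open>A\<close>, \<open>B\<close>, with eigenvalue \<open>sqrt (card A * card B)\<close>. A
  nonzero \<open>e\<close> perturbs it at a vertex \<open>v\<close> outside
  \<open>A \<union> B\<close>.\<close>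

definition bipartite_vec :: "'a set \<Rightarrow> 'a set \<Rightarrow> 'a \<Rightarrow> real \<Rightarrow> 'a \<Rightarrow> real" where
  "bipartite_vec A B v e = (\<lambda>x. if x \<in> A then sqrt (card B) else if x \<in> B then sqrt (card A)
     else if x = v then e else 0)"

text \<open>To be used with \<open>H\<close> the complement of a graph and \<open>A\<close>,
  \<open>B\<close> the two sides left by a separator; \<open>H\<close> may have further arcs
  anywhere.\<close>

locale complete_bipartite_subgraph = pair_graph H for H :: "'a pair_pre_digraph" +
  fixes A B :: "'a set"
  assumes sub: "A \<subseteq> pverts H" "B \<subseteq> pverts H" and disj: "A \<inter> B = {}"
    and ne: "A \<noteq> {}" "B \<noteq> {}" and arcs: "A \<times> B \<union> B \<times> A \<subseteq> parcs H"
begin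

lemma finite_parts: "finite A" "finite B"
  using sub pair_finite_verts by (auto intro: finite_subset)

lemma card_pos: "card A > 0" "card B > 0"
  using finite_parts ne by (auto simp: card_gt_0_iff)

lemma sum_bipartite_vec_arcs:
  "(\<Sum>(x, y)\<in>A \<times> B \<union> B \<times> A. bipartite_vec A B v e x * bipartite_vec A B v e y)
    = 2 * (card A * card B) * sqrt (card A * card B)"
proof -
  have "(\<Sum>(x, y)\<in>A \<times> B \<union> B \<times> A. bipartite_vec A B v e x * bipartite_vec A B v e y)
      = (\<Sum>(x, y)\<in>A \<times> B \<union> B \<times> A. sqrt (card A * card B))"
    using disj by (intro sum.cong) (auto simp: bipartite_vec_def real_sqrt_mult)
  also have "\<dots> = card (A \<times> B \<union> B \<times> A) * sqrt (card A * card B)"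
    by (simp add: case_prod_unfold)
  also have "card (A \<times> B \<union> B \<times> A) = card (A \<times> B) + card (B \<times> A)"
    using finite_parts disj by (intro card_Un_disjoint) auto
  finally show ?thesis
    by (simp add: card_cartesian_product ac_simps)
qed

lemma sum_bipartite_vec_square:
  fixes e :: real
  assumes "v \<in> pverts H"
  shows "(\<Sum>x\<in>pverts H. (bipartite_vec A B v e x)\<^sup>2)
    = 2 * (card A * card B) + (if v \<in> A \<union> B then 0 else e\<^sup>2)"
proof -
  let ?f = "\<lambda>x. (bipartite_vec A B v e x)\<^sup>2"
  have "(\<Sum>x\<in>pverts H. ?f x) = (\<Sum>x\<in>A \<union> B \<union> ({v} - (A \<union> B)). ?f x)"
    using sub assms pair_finite_verts
    by (intro sum.mono_neutral_right) (auto simp: bipartite_vec_def)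
  also have "\<dots> = (\<Sum>x\<in>A \<union> B. ?f x) + (\<Sum>x\<in>{v} - (A \<union> B). ?f x)"
    using finite_parts by (intro sum.union_disjoint) auto
  also have "(\<Sum>x\<in>A \<union> B. ?f x) = (\<Sum>x\<in>A. ?f x) + (\<Sum>x\<in>B. ?f x)"
    using finite_parts disj by (intro sum.union_disjoint) auto
  also have "(\<Sum>x\<in>A. ?f x) = (\<Sum>x\<in>A. real (card B))"
    by (intro sum.cong) (auto simp: bipartite_vec_def)
  also have "(\<Sum>x\<in>B. ?f x) = (\<Sum>x\<in>B. real (card A))"
    using disj by (intro sum.cong) (auto simp: bipartite_vec_def)
  also have "(\<Sum>x\<in>{v} - (A \<union> B). ?f x) = (if v \<in> A \<union> B then 0 else e\<^sup>2)"
    by (auto simp: bipartite_vec_def insert_Diff_if)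
  finally show ?thesis
    by simp
qed

text \<open>The test vector is nonnegative, so discarding arcs of \<open>H\<close> only lowers the
  quadratic form. An empty \<open>T\<close> yields the lower bound on the spectral radius, a single
  extra arc the equality case.\<close>

lemma bipartite_vec_rayleigh:
  fixes e :: real
  assumes "T \<subseteq> parcs H" and "T \<inter> (A \<times> B \<union> B \<times> A) = {}" and "v \<in> pverts H" and "e \<ge> 0"
  shows "2 * (card A * card B) * sqrt (card A * card B)
      + (\<Sum>(x, y)\<in>T. bipartite_vec A B v e x * bipartite_vec A B v e y)
    \<le> graph_spectral_radius H * (2 * (card A * card B) + (if v \<in> A \<union> B then 0 else e\<^sup>2))"
proof -
  let ?g = "\<lambda>(x, y). bipartite_vec A B v e x * bipartite_vec A B v e y"
  have "finite T"
    using assms(1) finite_subset pair_finite_arcs by blast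
  then have "2 * (card A * card B) * sqrt (card A * card B) + sum ?g T
      = sum ?g ((A \<times> B \<union> B \<times> A) \<union> T)"
    using assms(2) finite_parts
    by (subst sum.union_disjoint) (auto simp: sum_bipartite_vec_arcs)
  also have "\<dots> \<le> sum ?g (parcs H)"
    using assms(1,4) arcs pair_finite_arcs by (intro sum_mono2) (auto simp: bipartite_vec_def)
  also have "\<dots> \<le> graph_spectral_radius H * (\<Sum>x\<in>pverts H. (bipartite_vec A B v e x)\<^sup>2)"
    using assms(3) by (intro graph_rayleigh_le pair_graph) auto
  finally show ?thesis
    using sum_bipartite_vec_square[OF assms(3)] by simp
qed

lemma sqrt_card_le_spectral_radius: "sqrt (card A * card B) \<le> graph_spectral_radius H"
proof -
  obtain v where "v \<in> A" using ne by auto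
  then show ?thesis
    using bipartite_vec_rayleigh[of "{}" v 0] sub card_pos by (auto simp: ac_simps)
qed

text \<open>
  An additional arc at \<open>A \<union> B\<close> raises the Rayleigh quotient of the Perron vector of the complete
  bipartite graph, to first order in \<open>e\<close> if the arc leaves \<open>A \<union> B\<close> and \<open>e\<close> is put on its other end.
\<close>

lemma arcs_at_parts:
  assumes le: "graph_spectral_radius H \<le> sqrt (card A * card B)"
    and uv: "(u, v) \<in> parcs H" and u: "u \<in> A \<union> B"
  shows "(u, v) \<in> A \<times> B \<union> B \<times> A"
proof (rule ccontr)
  assume nin: "(u, v) \<notin> A \<times> B \<union> B \<times> A"
  define m where "m = real (card A * card B)"
  have m: "m > 0" using card_pos by (simp add: m_def)
  have v: "v \<in> pverts H" using uv by (rule in_arcsD2)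
  define p where "p = bipartite_vec A B v 0 u"
  have p: "p > 0" and pe: "bipartite_vec A B v e u = p" for e
    using u card_pos by (auto simp: p_def bipartite_vec_def)
  \<comment> \<open>The main terms \<open>2 * m * sqrt m\<close> cancel, leaving the gain from the
    extra arc against the growth of the squared norm.\<close>
  have ineq: "p * bipartite_vec A B v e v \<le> sqrt m * (if v \<in> A \<union> B then 0 else e\<^sup>2)"
    if e: "e \<ge> 0" for e :: real
  proof -
    have "2 * m * sqrt m + p * bipartite_vec A B v e v
        \<le> graph_spectral_radius H * (2 * m + (if v \<in> A \<union> B then 0 else e\<^sup>2))"
      using bipartite_vec_rayleigh[of "{(u, v)}" v e] uv nin v e pe by (simp add: m_def)
    also have "\<dots> \<le> sqrt m * (2 * m + (if v \<in> A \<union> B then 0 else e\<^sup>2))"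
      using le m by (intro mult_right_mono) (auto simp: m_def)
    finally show ?thesis by (simp add: algebra_simps)
  qed
  show False
  proof (cases "v \<in> A \<union> B")
    case True
    \<comment> \<open>With both ends in \<open>A \<union> B\<close> the gain is positive while the
      squared norm does not change.\<close>
    then have "bipartite_vec A B v 0 v > 0"
      using card_pos by (auto simp: bipartite_vec_def)
    then show False
      using ineq[of 0] True p by (simp add: mult_le_0_iff)
  next
    case False
    \<comment> \<open>The linear gain \<open>p * e\<close> beats the quadratic loss
      \<open>sqrt m * e * e\<close> for every positive \<open>e\<close> below
      \<open>p / sqrt m\<close>; half of this threshold is taken.\<close>
    define e where "e = p / (2 * sqrt m)"
    have e: "e > 0" using p m by (simp add: e_def)
    have "bipartite_vec A B v e v = e"
      using False by (simp add: bipartite_vec_def)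
    then have "p * e \<le> sqrt m * e * e"
      using ineq[of e] False e by (simp add: power2_eq_square ac_simps)
    then have "p \<le> sqrt m * e" using e by simp
    then show False using p m by (simp add: e_def)
  qed
qed

end

section \<open>Separators\<close>

lemma pair_graph_complement_graph:
  assumes "pair_graph G"
  shows "pair_graph (complement_graph G)"
proof -
  interpret pair_graph G by fact
  have "finite (parcs (complement_graph G))"
    by (rule finite_subset[of _ "pverts G \<times> pverts G"])
       (auto simp: complement_graph_def pair_finite_verts)
  then show ?thesis
    by unfold_locales
       (auto simp: complement_graph_def symmetric_def sym_def pair_finite_verts arcs_symmetric)
qed

text \<open>One side consists of the vertices reachable from some \<open>u\<close> that does not
  reach everything; no arc leaves it, and by symmetry none enters it.\<close>

lemma not_connected_separation:
  fixes G :: "'a pair_pre_digraph"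
  assumes "pair_graph G" and "\<not> Digraph_Component.connected (induce_subgraph G U)" and "U \<noteq> {}"
  obtains A B where "A \<union> B = U" "A \<inter> B = {}" "A \<noteq> {}" "B \<noteq> {}"
    and "parcs G \<inter> (A \<times> B \<union> B \<times> A) = {}"
proof -
  interpret pair_graph G by fact
  \<comment> \<open>\<open>connected\<close> is strong connectivity of the symmetric closure, which
    adds no arcs here. It also fails on an empty vertex set, so \<open>U \<noteq> {}\<close> is what
    makes its failure produce a pair \<open>u\<close>, \<open>v\<close>.\<close>
  let ?M = "mk_symmetric (induce_subgraph G U)"
  have M: "parcs ?M = parcs G \<inter> U \<times> U"
    using arcs_symmetric by (auto simp: parcs_mk_symmetric)
  interpret M: pair_wf_digraph ?M
    by (unfold_locales, auto simp: M)
  obtain u v where uv: "u \<in> U" "v \<in> U" "\<not> u \<rightarrow>\<^sup>*\<^bsub>?M\<^esub> v"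
    using assms(2,3) by (auto simp: Digraph_Component.connected_def strongly_connected_def)
  define A where "A = {x \<in> U. u \<rightarrow>\<^sup>*\<^bsub>?M\<^esub> x}"
  have no_arc: "(x, y) \<notin> parcs G" if "x \<in> A" "y \<in> U - A" for x y
  proof
    assume "(x, y) \<in> parcs G"
    then have "x \<rightarrow>\<^bsub>?M\<^esub> y"
      using that by (auto simp: M A_def)
    then have "u \<rightarrow>\<^sup>*\<^bsub>?M\<^esub> y"
      using that M.reachable_adj_trans by (auto simp: A_def)
    then show False using that by (auto simp: A_def)
  qed
  show thesis
  proof (rule that[of A "U - A"])
    show "A \<noteq> {}" using uv M.reachable_refl[of u] by (auto simp: A_def)
    show "parcs G \<inter> (A \<times> (U - A) \<union> (U - A) \<times> A) = {}"
      using no_arc arcs_symmetric by blast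
  qed (use uv in \<open>auto simp: A_def\<close>)
qed

lemma out_degree_eq_card_neighbours:
  fixes G :: "'a pair_pre_digraph"
  shows "out_degree G u = card {v. (u, v) \<in> parcs G}"
proof -
  have "out_arcs G u = Pair u ` {v. (u, v) \<in> parcs G}"
    by (auto simp: out_arcs_def)
  then show ?thesis
    by (simp add: out_degree_def card_image inj_on_def)
qed

text \<open>All neighbours of a vertex of \<open>A\<close> lie in \<open>A\<close> without that
  vertex or in \<open>S\<close>.\<close>

lemma min_degree_le_of_separation:
  fixes G :: "'a pair_pre_digraph"
  assumes "pair_graph G" and V: "pverts G = A \<union> B \<union> S" and "A \<noteq> {}"
    and no: "parcs G \<inter> A \<times> B = {}"
  shows "min_degree G + 1 \<le> card A + card S"
proof -
  interpret pair_graph G by fact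
  have fin: "finite A" "finite S"
    using pair_finite_verts by (auto simp: V)
  obtain u where u: "u \<in> A" using \<open>A \<noteq> {}\<close> by auto
  have "{v. (u, v) \<in> parcs G} \<subseteq> (A - {u}) \<union> S"
    using u no in_arcsD2 no_loops' unfolding V by blast
  then have "out_degree G u \<le> card ((A - {u}) \<union> S)"
    unfolding out_degree_eq_card_neighbours using fin by (intro card_mono) auto
  also have "\<dots> \<le> card (A - {u}) + card S"
    by (rule card_Un_le)
  finally have "out_degree G u + 1 \<le> card A + card S"
    using card_Suc_Diff1[OF fin(1) u] by linarith
  moreover have "min_degree G \<le> out_degree G u"
    unfolding min_degree_def using u pair_finite_verts by (intro Min_le) (auto simp: V)
  ultimately show ?thesis by simp
qed

text \<open>In the complement, the arcs at \<open>A \<union> B\<close> are exactly those between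
  \<open>A\<close> and \<open>B\<close>. Hence in \<open>G\<close> every vertex of \<open>S\<close>
  is adjacent to all of \<open>A \<union> B\<close>, and \<open>G\<close> is the join of the
  complement of that complete bipartite graph with the graph induced on \<open>S\<close>.\<close>

lemma mem_EC_of_complement_arcs:
  fixes G :: "'a pair_pre_digraph"
  assumes G: "pair_graph G" and V: "pverts G = A \<union> B \<union> S"
    and disj: "A \<inter> B = {}" "A \<inter> S = {}" "B \<inter> S = {}" and ne: "A \<noteq> {}"
    and no: "parcs G \<inter> (A \<times> B \<union> B \<times> A) = {}"
    and arcs: "\<And>u v. (u, v) \<in> parcs (complement_graph G) \<Longrightarrow> u \<in> A \<union> B \<Longrightarrow>
      (u, v) \<in> A \<times> B \<union> B \<times> A"
    and n: "card (pverts G) = n" and s: "s \<ge> 1" "card S = s - 1"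
    and A: "int (card A) = int k - int s + 2" and B: "int (card B) = int n - int k - 1"
  shows "G \<in> EC n k s"
proof -
  interpret pair_graph G by fact
  have fin: "finite A" "finite B" "finite S"
    using pair_finite_verts by (auto simp: V)
  define G1 where "G1 = \<lparr> pverts = A \<union> B, parcs = A \<times> B \<union> B \<times> A \<rparr>"
  define G2 where "G2 = \<lparr> pverts = S, parcs = parcs G \<inter> S \<times> S \<rparr>"
  have G1: "pair_graph G1"
    by unfold_locales (use fin disj in \<open>auto simp: G1_def symmetric_def sym_def\<close>)
  have G2: "pair_graph G2"
    by unfold_locales
      (use fin no_loops' arcs_symmetric in \<open>auto simp: G2_def symmetric_def sym_def\<close>)
  have degB: "out_degree G1 u = card A" if "u \<in> B" for u
    unfolding out_degree_eq_card_neighbours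
    using that disj by (intro arg_cong[where f = card]) (auto simp: G1_def)
  have degA: "out_degree G1 u = card B" if "u \<in> A" for u
    unfolding out_degree_eq_card_neighbours
    using that disj by (intro arg_cong[where f = card]) (auto simp: G1_def)
  have arc: "(u, v) \<in> parcs G" if "u \<in> A \<union> B" "v \<in> pverts G" "u \<noteq> v" "(u, v) \<notin> A \<times> B \<union> B \<times> A" for u v
    using arcs[of u v] that by (auto simp: complement_graph_def V)
  have arc': "(v, u) \<in> parcs G" if "u \<in> A \<union> B" "v \<in> pverts G" "u \<noteq> v" "(u, v) \<notin> A \<times> B \<union> B \<times> A" for u v
    using arc[OF that] arcs_symmetric by blast
  have "parcs G = parcs (join_graph (complement_graph G1) G2)"
  proof (intro subset_antisym subsetI)
    fix e assume e: "e \<in> parcs G"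
    obtain x y where xy: "e = (x, y)" by (cases e)
    have "x \<in> pverts G" "y \<in> pverts G" "x \<noteq> y" "(x, y) \<notin> A \<times> B \<union> B \<times> A"
      using e no in_arcsD1 in_arcsD2 no_loops' unfolding xy by auto
    then show "e \<in> parcs (join_graph (complement_graph G1) G2)"
      using e unfolding xy
      by (auto simp: join_graph_def complement_graph_def G1_def G2_def V)
  next
    fix e assume e: "e \<in> parcs (join_graph (complement_graph G1) G2)"
    obtain x y where xy: "e = (x, y)" by (cases e)
    show "e \<in> parcs G"
      using e disj arc[of x y] arc'[of y x] unfolding xy
      by (auto simp: join_graph_def complement_graph_def G1_def G2_def V)
  qed
  then have eq: "G = join_graph (complement_graph G1) G2"
    by (intro pair_pre_digraph.equality)
       (auto simp: join_graph_def complement_graph_def G1_def G2_def V)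
  \<comment> \<open>The parts are swapped: vertices of \<open>B\<close> have degree
    \<open>card A\<close>, the value prescribed for \<open>X\<close>. The witness for
    \<open>r\<close> is 0.\<close>
  have "semiregular_bipartite_with_parts G1 B A"
    using G1 disj degA degB
    by (auto simp: semiregular_bipartite_with_parts_def bipartite_with_parts_def G1_def)
  moreover have "int (card (pverts G1)) = int n - int s + 1 + 0"
    using fin disj A B s by (simp add: G1_def card_Un_disjoint)
  moreover have "pverts G1 \<noteq> {}" "pverts G1 \<inter> pverts G2 = {}"
    and "int (card (pverts G2)) = int s - 1 - 0" "int s - 1 - 0 \<ge> 0"
    using ne disj s by (auto simp: G1_def G2_def of_nat_diff)
  moreover have "\<forall>u\<in>B. int (out_degree G1 u) = int k - int s + 2"
    and "\<forall>v\<in>A. int (out_degree G1 v) = int n - int k - 1"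
    using degA degB A B by auto
  ultimately show ?thesis
    unfolding EC_def mem_Collect_eq using n eq G2
    by (intro conjI exI[of _ 0] exI[of _ G1] exI[of _ G2] exI[of _ B] exI[of _ A]) assumption+
qed

text \<open>Both sides have at least \<open>p = k + 1 - t\<close> elements, and
  \<open>a + b - p = n - k - 1\<close>, so the product exceeds \<open>p * (n - k - 1)\<close> by
  exactly \<open>(a - p) * (b - p)\<close>. The upper bound thus limits \<open>p\<close>, and then
  forces this excess to vanish.\<close>

lemma separation_cards:
  fixes a b t n k s :: nat
  assumes "k + 1 \<le> a + t" and "k + 1 \<le> b + t" and "a + b + t = n" and "t < s" and "s \<le> k + 1"
    and "n \<ge> 2 * k + 1" and "k \<ge> 1"
    and le: "int a * int b \<le> (int k - int s + 2) * (int n - int k - 1)"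
  shows "t = s - 1 \<and> (int a = int k - int s + 2 \<and> int b = int n - int k - 1 \<or>
    int b = int k - int s + 2 \<and> int a = int n - int k - 1)"
proof -
  define p where "p = int k + 1 - int t"
  have "(int a - p) * (int b - p) \<ge> 0"
    using assms by (intro mult_nonneg_nonneg) (auto simp: p_def)
  moreover have prod: "int a * int b = (int a - p) * (int b - p) + p * (int n - int k - 1)"
    using assms(3) by (simp add: p_def algebra_simps flip: assms(3))
  ultimately have "p * (int n - int k - 1) \<le> (int k - int s + 2) * (int n - int k - 1)"
    using le by linarith
  \<comment> \<open>The cancelled factor \<open>n - k - 1\<close> is at least \<open>k\<close>,
    hence positive. The result says \<open>t \<ge> s - 1\<close>, and \<open>t < s\<close> leaves
    only equality.\<close>
  then have "p \<le> int k - int s + 2"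
    using assms by (auto simp: mult_le_cancel_right)
  then have t: "t + 1 = s"
    using assms by (auto simp: p_def)
  then have p: "p = int k - int s + 2"
    by (auto simp: p_def)
  have "(int a - p) * (int b - p) = 0"
    using prod le \<open>(int a - p) * (int b - p) \<ge> 0\<close> by (simp add: p)
  then have "int a = p \<or> int b = p" by simp
  then show ?thesis
    using t assms(3) by (auto simp: p)
qed

theorem theorem3p1:
  fixes G :: "'a pair_pre_digraph" and n k s :: nat
  assumes "s \<ge> 1" and "k \<ge> 1" and "int k - int s + 1 \<ge> 0" and "n \<ge> 2 * k + 1"
    and "pair_graph G" and "Digraph_Component.connected G" and "card (pverts G) = n"
    and "min_degree G \<ge> k"
    and "graph_spectral_radius (complement_graph G)
           \<le> sqrt ((real k - real s + 2) * (real n - real k - 1))"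
  shows "s_connected s G \<or> G \<in> EP n k \<or> G \<in> EC n k s"
proof (cases "s_connected s G")
  case False
  interpret pair_graph G by fact
  \<comment> \<open>Since \<open>s \<le> k + 1 < 2 * k + 1 \<le> n\<close>, the graph has enough
    vertices, so the failure must come from a set \<open>S\<close>; the same estimate leaves
    vertices outside \<open>S\<close>.\<close>
  obtain S where S: "S \<subseteq> pverts G" "card S < s"
    and nc: "\<not> Digraph_Component.connected (induce_subgraph G (pverts G - S))"
    using False assms(2-4,7) unfolding s_connected_def by auto
  have "pverts G - S \<noteq> {}"
    using S assms(2-4,7) card_mono[of S "pverts G"] finite_subset[OF S(1) pair_finite_verts] by auto
  then obtain A B where AB: "A \<union> B = pverts G - S" "A \<inter> B = {}" "A \<noteq> {}" "B \<noteq> {}"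
    and no: "parcs G \<inter> (A \<times> B \<union> B \<times> A) = {}"
    using not_connected_separation[OF assms(5) nc] by metis
  have V: "pverts G = A \<union> B \<union> S" "pverts G = B \<union> A \<union> S" and disj: "A \<inter> S = {}" "B \<inter> S = {}"
    using AB S by auto
  let ?H = "complement_graph G"
  interpret H: complete_bipartite_subgraph ?H A B
    by (intro complete_bipartite_subgraph.intro complete_bipartite_subgraph_axioms.intro
        pair_graph_complement_graph assms(5))
       (use AB no in \<open>auto simp: complement_graph_def V\<close>)
  have cards: "card A + card B + card S = n"
    using assms(7) AB(2) disj H.finite_parts finite_subset[OF S(1) pair_finite_verts]
    by (simp add: V(1) card_Un_disjoint Int_Un_distrib2)
  have "sqrt (card A * card B) \<le> sqrt ((real k - real s + 2) * (real n - real k - 1))"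
    using H.sqrt_card_le_spectral_radius assms(9) by linarith
  \<comment> \<open>The inequality is moved to the integers, where subtraction is not truncated and
    the cardinality argument applies.\<close>
  then have "real_of_int (int (card A) * int (card B))
      \<le> real_of_int ((int k - int s + 2) * (int n - int k - 1))"
    by simp
  then have prod_le: "int (card A) * int (card B) \<le> (int k - int s + 2) * (int n - int k - 1)"
    by (simp only: of_int_le_iff)
  have "parcs G \<inter> A \<times> B = {}" "parcs G \<inter> B \<times> A = {}"
    using no by blast+
  then have "k + 1 \<le> card A + card S" "k + 1 \<le> card B + card S"
    using min_degree_le_of_separation[OF assms(5) V(1) AB(3)]
      min_degree_le_of_separation[OF assms(5) V(2) AB(4)] assms(8) by auto
  then have t: "card S = s - 1"
    and ab: "int (card A) = int k - int s + 2 \<and> int (card B) = int n - int k - 1 \<or>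
      int (card B) = int k - int s + 2 \<and> int (card A) = int n - int k - 1"
    using separation_cards[OF _ _ cards S(2) _ assms(4,2) prod_le] assms(3) by auto
  \<comment> \<open>The upper bound assumed for the spectral radius now equals the lower bound from
    \<open>A\<close> and \<open>B\<close>, so the complement has no other arcs at these
    sets.\<close>
  from ab have "real (card A) * real (card B) = (real k - real s + 2) * (real n - real k - 1)"
  proof (elim disjE conjE)
    assume "int (card A) = int k - int s + 2" "int (card B) = int n - int k - 1"
    then have "real (card A) = real k - real s + 2" "real (card B) = real n - real k - 1"
      by linarith+
    then show ?thesis by simp
  next
    assume "int (card B) = int k - int s + 2" "int (card A) = int n - int k - 1"
    then have "real (card B) = real k - real s + 2" "real (card A) = real n - real k - 1"
      by linarith+
    then show ?thesis by simp
  qed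
  then have "graph_spectral_radius ?H \<le> sqrt (card A * card B)"
    using assms(9) by simp
  note arcs = H.arcs_at_parts[OF this]
  from ab have "G \<in> EC n k s"
  proof (elim disjE conjE)
    assume "int (card A) = int k - int s + 2" "int (card B) = int n - int k - 1"
    then show ?thesis
      using mem_EC_of_complement_arcs[OF assms(5) V(1) AB(2) disj AB(3) no arcs assms(7,1) t] by simp
  next
    \<comment> \<open>The smaller prescribed size \<open>k - s + 2\<close> must belong to the first
      set, so \<open>A\<close> and \<open>B\<close> exchange roles.\<close>
    assume "int (card B) = int k - int s + 2" "int (card A) = int n - int k - 1"
    moreover have "B \<inter> A = {}" "parcs G \<inter> (B \<times> A \<union> A \<times> B) = {}"
      and "\<And>u v. (u, v) \<in> parcs ?H \<Longrightarrow> u \<in> B \<union> A \<Longrightarrow> (u, v) \<in> B \<times> A \<union> A \<times> B"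
      using AB(2) no arcs by blast+
    ultimately show ?thesis
      using mem_EC_of_complement_arcs[OF assms(5) V(2) _ disj(2,1) AB(4) _ _ assms(7,1) t] by simp
  qed
  then show ?thesis by simp
qed simp

end
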